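(* Let $G$ be an arbitrary graph with Helly-gap $\alpha(G)$. Then (i) $\lfloor (2rad(G)-diam(G))/2\rfloor\le\alpha(G)\le\lfloor diam(G)/2\rfloor$, and (ii) for every integer $k\ge 1$, $\alpha(G^k)\le\lceil \alpha(G)/k\rceil$.
   Context: All graphs are finite, simple, undirected, unweighted and connected. $D_G(v,r)=\{u: d_G(u,v)\le r\}$. A graph $G$ is $\alpha$-weakly-Helly if for every family of pairwise intersecting disks $\{D_G(v,r(v)) : v\in S\}$, $S\subseteq V(G)$, the disks $D_G(v,r(v)+\alpha)$, $v\in S$, have a common vertex. The Helly-gap $\alpha(G)$ is the minimum $\alpha\ge 0$ for which $G$ is $\alpha$-weakly-Helly. $rad(G)$ and $diam(G)$ are the minimum and maximum vertex eccentricity. $G^k$ is the graph on $V(G)$ in which distinct vertices are adjacent iff their distance in $G$ is at most $k$. *)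

theory Defs
  imports Complex_Main "Graph_Theory.Graph_Theory"
begin

text \<open>
  Finite simple undirected graphs are the \<^locale>\<open>pair_graph\<close>s of the library: a finite vertex
  set \<open>pverts G\<close> and a symmetric, irreflexive arc set \<open>parcs G\<close>. The predicate \<^const>\<open>connected\<close>
  includes that the vertex set is non-empty. The notions below are only meaningful for
  connected graphs; in particular \<open>gdist\<close> is unspecified for vertices not joined by a walk.
\<close>

definition gdist :: "'a pair_pre_digraph \<Rightarrow> 'a \<Rightarrow> 'a \<Rightarrow> nat" where
  "gdist G u v = (LEAST n. \<exists>p. pre_digraph.awalk (with_proj G) u p v \<and> length p = n)"

definition disk :: "'a pair_pre_digraph \<Rightarrow> 'a \<Rightarrow> nat \<Rightarrow> 'a set" where
  "disk G v r = {u \<in> pverts G. gdist G u v \<le> r}"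

definition eccentricity :: "'a pair_pre_digraph \<Rightarrow> 'a \<Rightarrow> nat" where
  "eccentricity G v = Max (gdist G v ` pverts G)"

definition rad :: "'a pair_pre_digraph \<Rightarrow> nat" where
  "rad G = Min (eccentricity G ` pverts G)"

definition diam :: "'a pair_pre_digraph \<Rightarrow> nat" where
  "diam G = Max (eccentricity G ` pverts G)"

definition weakly_Helly :: "nat \<Rightarrow> 'a pair_pre_digraph \<Rightarrow> bool" where
  "weakly_Helly \<alpha> G \<longleftrightarrow>
    (\<forall>S r. S \<subseteq> pverts G \<longrightarrow>
       (\<forall>u\<in>S. \<forall>v\<in>S. disk G u (r u) \<inter> disk G v (r v) \<noteq> {}) \<longrightarrow>
       (\<exists>x\<in>pverts G. \<forall>v\<in>S. x \<in> disk G v (r v + \<alpha>)))"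

text \<open>
  Restricting radii and \<open>\<alpha>\<close> to natural numbers loses nothing: distances are integers, so a disk
  of real radius \<open>r \<ge> 0\<close> is the disk of radius \<open>\<lfloor>r\<rfloor>\<close>, and the least real \<open>\<alpha> \<ge> 0\<close> is an integer.
\<close>

definition Helly_gap :: "'a pair_pre_digraph \<Rightarrow> nat" where
  "Helly_gap G = (LEAST \<alpha>. weakly_Helly \<alpha> G)"

definition graph_power :: "'a pair_pre_digraph \<Rightarrow> nat \<Rightarrow> 'a pair_pre_digraph" where
  "graph_power G k =
    \<lparr> pverts = pverts G,
      parcs = {(u, v). u \<in> pverts G \<and> v \<in> pverts G \<and> u \<noteq> v \<and> gdist G u v \<le> k} \<rparr>"

end

theory Submission
  imports Defs
begin

text \<open>
  Lower bound: the disks of radius \<open>\<lceil>diam/2\<rceil>\<close> around all vertices pairwise intersect, and a common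
  vertex of the disks inflated by \<open>\<alpha>\<close> has eccentricity at most \<open>\<lceil>diam/2\<rceil> + \<alpha>\<close>.
  Upper bound: the inflation is \<open>\<lfloor>diam/2\<rfloor>\<close>. If a disk of the family has radius at most
  \<open>\<lfloor>diam/2\<rfloor>\<close>, then its centre lies in every inflated disk; otherwise every inflated disk
  contains all vertices.
  Powers: a disk of radius \<open>r\<close> in \<open>G\<^sup>k\<close> is the disk of radius \<open>k r\<close> in \<open>G\<close> with the same centre.
\<close>

section \<open>Walk lengths as relational powers of the arc set\<close>

lemma awalk_of_length_iff:
  "(\<exists>p. pre_digraph.awalk (with_proj G) u p v \<and> length p = n)
    \<longleftrightarrow> u \<in> pverts G \<and> (u, v) \<in> parcs G ^^ n"
proof -
  have "(\<exists>p. set p \<subseteq> parcs G \<and> pcas u p v \<and> length p = n) \<longleftrightarrow> (u, v) \<in> parcs G ^^ n"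
  proof (induction n arbitrary: u)
    case 0
    show ?case by auto
  next
    case (Suc n)
    have "(\<exists>p. set p \<subseteq> parcs G \<and> pcas u p v \<and> length p = Suc n)
        \<longleftrightarrow> (\<exists>w. (u, w) \<in> parcs G \<and> (\<exists>p. set p \<subseteq> parcs G \<and> pcas w p v \<and> length p = n))"
      (is "?L \<longleftrightarrow> ?R")
    proof
      assume ?L
      then obtain p where "set p \<subseteq> parcs G" "pcas u p v" "length p = Suc n" by blast
      then show ?R by (cases p) (auto, blast)
    next
      assume ?R
      then obtain w p where "(u, w) \<in> parcs G" "set p \<subseteq> parcs G" "pcas w p v" "length p = n"
        by blast
      then show ?L by (intro exI[of _ "(u, w) # p"]) auto
    qed
    also have "\<dots> \<longleftrightarrow> (u, v) \<in> parcs G ^^ Suc n"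
      by (auto simp: Suc.IH relpow_commute[symmetric])
    finally show ?case .
  qed
  then show ?thesis
    by (auto simp: pre_digraph.awalk_def cas_with_proj_eq)
qed

text \<open>Reachability makes the \<open>LEAST\<close> in \<open>gdist\<close> attained. Only
  reachability of this one pair is assumed, so the fact applies to a power graph without first
  showing that it is a connected \<open>pair_graph\<close>.\<close>

lemma gdist_le_iff:
  assumes "u \<in> pverts G" "(u, v) \<in> (parcs G)\<^sup>*"
  shows "gdist G u v \<le> n \<longleftrightarrow> (\<exists>m\<le>n. (u, v) \<in> parcs G ^^ m)"
proof -
  have eq: "gdist G u v = (LEAST m. (u, v) \<in> parcs G ^^ m)"
    using assms(1) by (simp add: gdist_def awalk_of_length_iff)
  obtain m where "(u, v) \<in> parcs G ^^ m"
    using assms(2) by (auto simp: rtrancl_power)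
  then have "(u, v) \<in> parcs G ^^ gdist G u v"
    unfolding eq by (rule LeastI)
  then show ?thesis
    unfolding eq by (meson Least_le order_trans)
qed

section \<open>The shortest-path metric of a connected graph\<close>

locale connected_pair_graph = pair_graph +
  assumes connected: "connected (with_proj G)"
begin

lemma pverts_nonempty: "pverts G \<noteq> {}"
  using connected by (simp add: connected_def strongly_connected_def)

text \<open>Connectedness speaks of reachability in \<open>mk_symmetric G\<close>, which adds no
  arcs because \<open>parcs G\<close> is already symmetric.\<close>

lemma rtrancl_parcs:
  assumes "u \<in> pverts G" "v \<in> pverts G"
  shows "(u, v) \<in> (parcs G)\<^sup>*"
proof -
  have "parcs (mk_symmetric G) = parcs G"
    unfolding parcs_mk_symmetric by (auto intro: arcs_symmetric)
  moreover have "u \<rightarrow>\<^sup>*\<^bsub>mk_symmetric G\<^esub> v"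
    using connected assms by (simp add: connected_def strongly_connected_def)
  ultimately show ?thesis
    using reachable_rtranclI by fastforce
qed

lemmas gdist_le_iff_relpow = gdist_le_iff[OF _ rtrancl_parcs]

lemma relpow_gdist:
  assumes "u \<in> pverts G" "v \<in> pverts G"
  shows "(u, v) \<in> parcs G ^^ gdist G u v"
proof -
  obtain m where "m \<le> gdist G u v" "(u, v) \<in> parcs G ^^ m"
    using gdist_le_iff_relpow[OF assms(1) assms] by blast
  moreover from this have "gdist G u v \<le> m"
    using gdist_le_iff_relpow[OF assms(1) assms] by blast
  ultimately show ?thesis by simp
qed

lemma gdist_le:
  assumes "u \<in> pverts G" "v \<in> pverts G" "(u, v) \<in> parcs G ^^ n"
  shows "gdist G u v \<le> n"
  using gdist_le_iff_relpow assms by blast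

lemma gdist_self: "u \<in> pverts G \<Longrightarrow> gdist G u u = 0"
  using gdist_le[of u u 0] by simp

lemma gdist_triangle:
  assumes "u \<in> pverts G" "v \<in> pverts G" "w \<in> pverts G"
  shows "gdist G u w \<le> gdist G u v + gdist G v w"
  using assms by (intro gdist_le) (auto simp: relpow_add intro: relpow_gdist)

lemma gdist_commute_le:
  assumes "u \<in> pverts G" "v \<in> pverts G"
  shows "gdist G v u \<le> gdist G u v"
proof -
  have "(v, u) \<in> parcs G ^^ n" if "(u, v) \<in> parcs G ^^ n" for n
    using that
  proof (induction n arbitrary: v)
    case (Suc n)
    then obtain w where "(u, w) \<in> parcs G ^^ n" "(w, v) \<in> parcs G" by auto
    then show ?case
      using Suc.IH arcs_symmetric relpow_Suc_I2 by metis
  qed simp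
  then show ?thesis
    using assms by (simp add: gdist_le relpow_gdist)
qed

lemma gdist_commute:
  assumes "u \<in> pverts G" "v \<in> pverts G"
  shows "gdist G u v = gdist G v u"
  using assms by (intro antisym gdist_commute_le)

lemma relpow_parcs_in_pverts:
  "(u, v) \<in> parcs G ^^ n \<Longrightarrow> u \<in> pverts G \<Longrightarrow> v \<in> pverts G"
  by (cases n) (auto dest: in_arcsD2)

text \<open>A converse to the triangle inequality: cut a shortest walk after \<open>m\<close> arcs.
  If the walk has at most \<open>m\<close> arcs, its end \<open>v\<close> serves as
  \<open>w\<close>.\<close>

lemma gdist_split:
  assumes "u \<in> pverts G" "v \<in> pverts G" "gdist G u v \<le> m + n"
  obtains w where "w \<in> pverts G" "gdist G u w \<le> m" "gdist G w v \<le> n"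
proof (cases "gdist G u v \<le> m")
  case True
  then show ?thesis using that[of v] assms by (simp add: gdist_self)
next
  case False
  then have "(u, v) \<in> parcs G ^^ (m + (gdist G u v - m))"
    using relpow_gdist[OF assms(1,2)] by simp
  then obtain w where w: "(u, w) \<in> parcs G ^^ m" "(w, v) \<in> parcs G ^^ (gdist G u v - m)"
    by (auto simp: relpow_add)
  then have "w \<in> pverts G"
    using assms(1) relpow_parcs_in_pverts by blast
  with w have "gdist G u w \<le> m" "gdist G w v \<le> gdist G u v - m"
    using assms by (auto intro: gdist_le)
  then show ?thesis using that \<open>w \<in> pverts G\<close> assms(3) by force
qed

text \<open>Turns pairwise intersection into a distance condition: the triangle inequality gives one
  direction, \<open>gdist_split\<close> the other.\<close>

lemma disks_intersect_iff:
  assumes "u \<in> pverts G" "v \<in> pverts G"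
  shows "disk G u r \<inter> disk G v s \<noteq> {} \<longleftrightarrow> gdist G u v \<le> r + s"
proof
  assume "disk G u r \<inter> disk G v s \<noteq> {}"
  then obtain w where w: "w \<in> pverts G" "gdist G w u \<le> r" "gdist G w v \<le> s"
    by (auto simp: disk_def)
  then show "gdist G u v \<le> r + s"
    using gdist_triangle[of u w v] gdist_commute[of u w] assms by simp
next
  assume "gdist G u v \<le> r + s"
  then obtain w where "w \<in> pverts G" "gdist G u w \<le> r" "gdist G w v \<le> s"
    using gdist_split assms by blast
  then show "disk G u r \<inter> disk G v s \<noteq> {}"
    using gdist_commute[of u w] assms by (auto simp: disk_def)
qed

section \<open>Radius, diameter and the weak Helly property\<close>

lemma gdist_le_diam:
  assumes "u \<in> pverts G" "v \<in> pverts G"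
  shows "gdist G u v \<le> diam G"
proof -
  have "gdist G u v \<le> eccentricity G u"
    unfolding eccentricity_def using assms pair_finite_verts by (intro Max_ge) auto
  also have "\<dots> \<le> diam G"
    unfolding diam_def using assms pair_finite_verts by (intro Max_ge) auto
  finally show ?thesis .
qed

lemma rad_le:
  assumes "x \<in> pverts G" "\<And>v. v \<in> pverts G \<Longrightarrow> gdist G x v \<le> n"
  shows "rad G \<le> n"
proof -
  have "rad G \<le> eccentricity G x"
    unfolding rad_def using assms pair_finite_verts by (intro Min_le) auto
  also have "\<dots> \<le> n"
    unfolding eccentricity_def using assms pair_finite_verts by (subst Max_le_iff) auto
  finally show ?thesis .
qed

lemma rad_le_weakly_Helly:
  assumes "weakly_Helly \<alpha> G"
  shows "rad G \<le> (diam G + 1) div 2 + \<alpha>"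
proof -
  \<comment> \<open>Rounding up ensures that \<open>?r + ?r\<close> is at least
    \<open>diam G\<close>, also for odd diameter.\<close>
  let ?r = "(diam G + 1) div 2"
  have "disk G u ?r \<inter> disk G v ?r \<noteq> {}" if "u \<in> pverts G" "v \<in> pverts G" for u v
    using gdist_le_diam[OF that] disks_intersect_iff[OF that] by simp
  then obtain x where "x \<in> pverts G" "\<forall>v\<in>pverts G. x \<in> disk G v (?r + \<alpha>)"
    using assms[unfolded weakly_Helly_def, rule_format, of "pverts G" "\<lambda>_. ?r"] by auto
  then show ?thesis by (intro rad_le) (auto simp: disk_def)
qed

lemma weakly_Helly_half_diam: "weakly_Helly (diam G div 2) G"
  unfolding weakly_Helly_def
proof (intro allI impI)
  fix S r
  assume S: "S \<subseteq> pverts G" and int: "\<forall>u\<in>S. \<forall>v\<in>S. disk G u (r u) \<inter> disk G v (r v) \<noteq> {}"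
  show "\<exists>x\<in>pverts G. \<forall>v\<in>S. x \<in> disk G v (r v + diam G div 2)"
  proof (cases "\<exists>v\<in>S. r v \<le> diam G div 2")
    case True
    then obtain x where x: "x \<in> S" "r x \<le> diam G div 2" by blast
    \<comment> \<open>The disk around \<open>x\<close> meets the one around \<open>v\<close>, so
      \<open>x\<close> is within \<open>r x + r v\<close> of \<open>v\<close>, and the inflation
      absorbs \<open>r x\<close>.\<close>
    have "x \<in> disk G v (r v + diam G div 2)" if "v \<in> S" for v
    proof -
      have "gdist G x v \<le> r x + r v"
        using int x S that disks_intersect_iff[of x v "r x" "r v"] by blast
      then show ?thesis using x S by (auto simp: disk_def)
    qed
    then show ?thesis using x S by blast
  next
    case False
    \<comment> \<open>Any vertex will do, also when \<open>S\<close> is empty. Each radius is at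
      least \<open>diam G div 2 + 1\<close>, and this extra 1 covers odd diameters.\<close>
    obtain x where x: "x \<in> pverts G" using pverts_nonempty by blast
    have "x \<in> disk G v (r v + diam G div 2)" if "v \<in> S" for v
    proof -
      have "r v > diam G div 2" using False that by force
      then show ?thesis
        using x S that gdist_le_diam[of x v] by (auto simp: disk_def)
    qed
    then show ?thesis using x by blast
  qed
qed

section \<open>Distances and disks in graph powers\<close>

lemma graph_power_relpow_imp_gdist_le:
  assumes "(u, v) \<in> parcs (graph_power G k) ^^ n" "u \<in> pverts G"
  shows "v \<in> pverts G \<and> gdist G u v \<le> k * n"
  using assms
proof (induction n arbitrary: v)
  case 0
  then show ?case by (simp add: gdist_self)
next
  case (Suc n)
  obtain w where w: "(u, w) \<in> parcs (graph_power G k) ^^ n" "(w, v) \<in> parcs (graph_power G k)"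
    using Suc.prems(1) by auto
  have "w \<in> pverts G" "v \<in> pverts G" "gdist G w v \<le> k"
    using w(2) by (simp_all add: graph_power_def)
  then show ?case
    using Suc.IH[OF w(1) Suc.prems(2)] Suc.prems(2) gdist_triangle[of u w v] by simp
qed

text \<open>Induction splits off a last piece of length at most \<open>k\<close>, which is one arc
  of the power. A piece may be trivial and the power has no loops, hence \<open>m \<le> n\<close>
  instead of exactly \<open>n\<close> arcs.\<close>

lemma gdist_le_imp_graph_power_relpow:
  assumes "gdist G u v \<le> k * n" "u \<in> pverts G" "v \<in> pverts G"
  shows "\<exists>m\<le>n. (u, v) \<in> parcs (graph_power G k) ^^ m"
  using assms
proof (induction n arbitrary: v)
  case 0
  then show ?case using relpow_gdist[of u v] by simp
next
  case (Suc n)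
  then obtain w where w: "w \<in> pverts G" "gdist G u w \<le> k * n" "gdist G w v \<le> k"
    using gdist_split[of u v "k * n" k] by (auto simp: add.commute)
  then obtain m where m: "m \<le> n" "(u, w) \<in> parcs (graph_power G k) ^^ m"
    using Suc by blast
  show ?case
  proof (cases "w = v")
    case True
    then show ?thesis using m le_SucI by blast
  next
    case False
    then have "(w, v) \<in> parcs (graph_power G k)"
      using w Suc.prems by (simp add: graph_power_def)
    then have "(u, v) \<in> parcs (graph_power G k) ^^ Suc m"
      using m by auto
    then show ?thesis using m(1) by blast
  qed
qed

text \<open>The distance in the power is the distance in \<open>G\<close> divided by
  \<open>k\<close> and rounded up, expressed without division.\<close>

lemma gdist_graph_power_le_iff:
  assumes "k \<ge> 1" "u \<in> pverts G" "v \<in> pverts G"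
  shows "gdist (graph_power G k) u v \<le> n \<longleftrightarrow> gdist G u v \<le> k * n"
proof -
  \<comment> \<open>This crude bound serves only to show that \<open>v\<close> is reachable from
    \<open>u\<close> in the power.\<close>
  have "gdist G u v \<le> k * gdist G u v" using assms(1) by simp
  then have "(u, v) \<in> (parcs (graph_power G k))\<^sup>*"
    using gdist_le_imp_graph_power_relpow assms by (meson relpow_imp_rtrancl)
  moreover have "u \<in> pverts (graph_power G k)"
    using assms by (simp add: graph_power_def)
  ultimately have "gdist (graph_power G k) u v \<le> n
      \<longleftrightarrow> (\<exists>m\<le>n. (u, v) \<in> parcs (graph_power G k) ^^ m)"
    by (intro gdist_le_iff)
  also have "\<dots> \<longleftrightarrow> gdist G u v \<le> k * n"
    using graph_power_relpow_imp_gdist_le gdist_le_imp_graph_power_relpow assms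
    by (meson mult_le_mono2 order_trans)
  finally show ?thesis .
qed

lemma disk_graph_power:
  assumes "k \<ge> 1" "v \<in> pverts G"
  shows "disk (graph_power G k) v r = disk G v (k * r)"
proof -
  have "pverts (graph_power G k) = pverts G" by (simp add: graph_power_def)
  then show ?thesis
    using gdist_graph_power_le_iff[OF assms(1) _ assms(2)] unfolding disk_def by blast
qed

text \<open>Scale all radii by \<open>k\<close> and apply the property in \<open>G\<close>;
  inflating by \<beta> in the power means inflating by \<open>k * \<beta>\<close> in
  \<open>G\<close>, which covers \<alpha>.\<close>

lemma weakly_Helly_graph_power:
  assumes "weakly_Helly \<alpha> G" "k \<ge> 1" "\<alpha> \<le> k * \<beta>"
  shows "weakly_Helly \<beta> (graph_power G k)"
  unfolding weakly_Helly_def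
proof (intro allI impI)
  fix S r
  let ?H = "graph_power G k"
  assume "S \<subseteq> pverts ?H" and int: "\<forall>u\<in>S. \<forall>v\<in>S. disk ?H u (r u) \<inter> disk ?H v (r v) \<noteq> {}"
  then have S: "S \<subseteq> pverts G" by (simp add: graph_power_def)
  have disk: "disk ?H v n = disk G v (k * n)" if "v \<in> S" for v n
    using disk_graph_power[OF assms(2)] S that by blast
  have "\<forall>u\<in>S. \<forall>v\<in>S. disk G u (k * r u) \<inter> disk G v (k * r v) \<noteq> {}"
    using int by (simp add: disk)
  then obtain x where x: "x \<in> pverts G" "\<forall>v\<in>S. x \<in> disk G v (k * r v + \<alpha>)"
    using assms(1)[unfolded weakly_Helly_def, rule_format, of S "\<lambda>v. k * r v"] S by auto
  have "x \<in> disk ?H v (r v + \<beta>)" if "v \<in> S" for v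
  proof -
    have "k * r v + \<alpha> \<le> k * (r v + \<beta>)" using assms(3) by (simp add: distrib_left)
    moreover have "x \<in> pverts G" "gdist G x v \<le> k * r v + \<alpha>"
      using x that by (auto simp: disk_def)
    ultimately show ?thesis
      unfolding disk[OF that] by (simp add: disk_def)
  qed
  then show "\<exists>x\<in>pverts ?H. \<forall>v\<in>S. x \<in> disk ?H v (r v + \<beta>)"
    using x(1) by (auto simp: graph_power_def)
qed

text \<open>The half-diameter bound supplies the witness that makes the minimum exist.\<close>

lemma weakly_Helly_Helly_gap: "weakly_Helly (Helly_gap G) G"
  unfolding Helly_gap_def using weakly_Helly_half_diam by (rule LeastI)

end

lemma Helly_gap_le: "weakly_Helly \<alpha> G \<Longrightarrow> Helly_gap G \<le> \<alpha>"
  unfolding Helly_gap_def by (rule Least_le)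

theorem theorem3:
  fixes G :: "'a pair_pre_digraph"
  assumes "pair_graph G"
    and "connected (with_proj G)"
  shows "\<lfloor>(2 * real (rad G) - real (diam G)) / 2\<rfloor> \<le> int (Helly_gap G)
      \<and> int (Helly_gap G) \<le> \<lfloor>real (diam G) / 2\<rfloor>
      \<and> (\<forall>k::nat. k \<ge> 1 \<longrightarrow>
            int (Helly_gap (graph_power G k)) \<le> \<lceil>real (Helly_gap G) / real k\<rceil>)"
proof (intro conjI allI impI)
  interpret connected_pair_graph G
    using assms by (simp add: connected_pair_graph_def connected_pair_graph_axioms_def)
  have "rad G \<le> (diam G + 1) div 2 + Helly_gap G"
    using rad_le_weakly_Helly[OF weakly_Helly_Helly_gap] .
  then have "2 * rad G \<le> diam G + 1 + 2 * Helly_gap G" by simp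
  then have "2 * real (rad G) \<le> real (diam G) + 1 + 2 * real (Helly_gap G)" by linarith
  \<comment> \<open>The quotient is at most \<open>Helly_gap G + 1/2\<close>; the floor removes the
    half that came from rounding the radius up.\<close>
  then show "\<lfloor>(2 * real (rad G) - real (diam G)) / 2\<rfloor> \<le> int (Helly_gap G)"
    unfolding floor_le_iff by simp
  have "Helly_gap G \<le> diam G div 2"
    using Helly_gap_le[OF weakly_Helly_half_diam] .
  then have "2 * Helly_gap G \<le> diam G" by simp
  then show "int (Helly_gap G) \<le> \<lfloor>real (diam G) / 2\<rfloor>"
    unfolding le_floor_iff by simp
  fix k :: nat
  assume k: "k \<ge> 1"
  let ?c = "\<lceil>real (Helly_gap G) / real k\<rceil>"
  have "0 \<le> real (Helly_gap G) / real k" by simp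
  \<comment> \<open>The ceiling is nonnegative, so \<open>nat ?c\<close> is a faithful choice of
    \<beta> in \<open>weakly_Helly_graph_power\<close>.\<close>
  then have c: "int (nat ?c) = ?c" by linarith
  have "real (Helly_gap G) / real k \<le> real (nat ?c)"
    by (rule real_nat_ceiling_ge)
  then have "real (Helly_gap G) \<le> real (k * nat ?c)"
    using k pos_divide_le_eq[of "real k"] by (metis less_le_trans mult.commute of_nat_0_less_iff
        of_nat_mult zero_less_one)
  then have "Helly_gap G \<le> k * nat ?c" by (simp only: of_nat_le_iff)
  then have "Helly_gap (graph_power G k) \<le> nat ?c"
    using Helly_gap_le weakly_Helly_graph_power[OF weakly_Helly_Helly_gap k] by blast
  then show "int (Helly_gap (graph_power G k)) \<le> ?c" using c by linarith
qed

end
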